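(* Let $m,n$ be relatively prime positive integers. A dominant affine permutation $w\in\widetilde{\mathfrak{S}}_n$ satisfies $w^{-1}\in\mathcal{S}_m^n$ if and only if $[w(1),w(2),\ldots,w(n)]=n(\mathfrak{b})$ (as sorted lists) for some balanced $(m,n)$-filter $\mathfrak{b}$.
   Context: $\widetilde{\mathfrak{S}}_n$ is the group of bijections $w:\mathbb{Z}\to\mathbb{Z}$ with $w(i+n)=w(i)+n$ and $\sum_{i=1}^n w(i)=\binom{n+1}{2}$; $w$ is dominant if $w(1)<\cdots<w(n)$. $\mathcal{S}_m^n$ is the Sommers region, the region bounded by the $n$ affine hyperplanes of height $m$ in the affine $\widetilde{\mathfrak{S}}_n$ arrangement; $w^{-1}\in\mathcal{S}_m^n$ means $w^{-1}$ labels an alcove in it, equivalently (known characterization) $w(i)-w(j)\ne m$ for all integers $i<j$. The level of $(i,j)\in\mathbb{Z}^2$ is $\ell(i,j)=im+jn$. An $(m,n)$-filter is a nonempty proper upward-closed (componentwise order) subset $\mathfrak{i}\subsetneq\mathbb{Z}^2$ such that whenever $(i,j)\in\mathfrak{i}$ all points of the same level lie in $\mathfrak{i}$. $m(\mathfrak{i})$ is the set of $\min\{\ell(i,j):(i,j)\in\mathfrak{i}\}$ over $j\in\mathbb{Z}$ (minimum over $i$, $j$ fixed), $n(\mathfrak{i})$ the set of $\min\{\ell(i,j):(i,j)\in\mathfrak{i}\}$ over $i\in\mathbb{Z}$ (minimum over $j$, $i$ fixed). An $(m,n)$-filter $\mathfrak{b}$ is balanced if $\sum_{x\in m(\mathfrak{b})}x=\binom{m+1}{2}$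 and $\sum_{y\in n(\mathfrak{b})}y=\binom{n+1}{2}$. *)

theory Defs
  imports Complex_Main
begin

definition affine_sym :: "nat \<Rightarrow> (int \<Rightarrow> int) set" where
  "affine_sym n = {w. bij w \<and> (\<forall>i. w (i + int n) = w i + int n)
     \<and> (\<Sum>i = 1..int n. w i) = int ((n + 1) choose 2)}"

definition dominant :: "nat \<Rightarrow> (int \<Rightarrow> int) \<Rightarrow> bool" where
  "dominant n w \<longleftrightarrow> strict_mono_on {1..int n} w"


text \<open>
  The affine arrangement lives in the hyperplane \<open>x\<^sub>1 + \<dots> + x\<^sub>n = 0\<close> of \<open>\<real>\<^sup>n\<close>.
  A point is a function on the integers that vanishes outside the index set \<open>{1..n}\<close>.
\<close>

definition coweight_space :: "nat \<Rightarrow> (int \<Rightarrow> real) set" where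
  "coweight_space n =
     {x. (\<forall>i. i \<notin> {1..int n} \<longrightarrow> x i = 0) \<and> (\<Sum>i = 1..int n. x i) = 0}"

text \<open>
  The triple \<open>(i, j, k)\<close> stands for the affine root \<open>e\<^sub>i - e\<^sub>j + k\<delta>\<close>, that is, for the affine
  function \<open>x\<^sub>i - x\<^sub>j + k\<close>. The hyperplanes of the arrangement are the zero sets of these
  functions. The simple affine roots \<open>e\<^sub>i - e\<^sub>i\<^sub>+\<^sub>1\<close> (\<open>1 \<le> i < n\<close>) and \<open>e\<^sub>n - e\<^sub>1 + \<delta>\<close> have height 1, and so
  \<open>\<delta>\<close> has height \<open>n\<close>. Opposite roots have the same zero set and opposite heights; the height
  of a hyperplane is that of its positive root.
\<close>

definition affine_roots :: "nat \<Rightarrow> (int \<times> int \<times> int) set" where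
  "affine_roots n = {(i, j, k). i \<in> {1..int n} \<and> j \<in> {1..int n} \<and> i \<noteq> j}"

fun root_val :: "int \<times> int \<times> int \<Rightarrow> (int \<Rightarrow> real) \<Rightarrow> real" where
  "root_val (i, j, k) x = x i - x j + of_int k"

fun root_height :: "nat \<Rightarrow> int \<times> int \<times> int \<Rightarrow> int" where
  "root_height n (i, j, k) = j - i + k * int n"

definition fundamental_alcove :: "nat \<Rightarrow> (int \<Rightarrow> real) set" where
  "fundamental_alcove n =
     {x \<in> coweight_space n. (\<forall>i. 1 \<le> i \<and> i < int n \<longrightarrow> x i > x (i + 1)) \<and> x 1 - x (int n) < 1}"

text \<open>
  The (open) region bounded by the \<open>n\<close> hyperplanes of height \<open>m\<close>. Roots of positive height
  are positive on the fundamental alcove, so this is the side of each hyperplane on which the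
  fundamental alcove lies; for \<open>m\<close> coprime to \<open>n\<close> it is the interior of a simplex, and for
  \<open>m = 1\<close> it is the fundamental alcove.
\<close>

definition sommers_region :: "nat \<Rightarrow> nat \<Rightarrow> (int \<Rightarrow> real) set" where
  "sommers_region m n =
     {x \<in> coweight_space n. \<forall>r \<in> affine_roots n. root_height n r = int m \<longrightarrow> root_val r x > 0}"

text \<open>
  Extend the coordinates of \<open>x\<close> to all integers by \<open>x (i + n) = x i - 1\<close>. An affine permutation
  \<open>w\<close> then acts on the right by \<open>x \<mapsto> x \<circ> w\<close>, and \<open>w\<close> labels the image of the fundamental
  alcove: on it the extended coordinates satisfy \<open>x i > x j\<close> iff \<open>w i < w j\<close>. (For the left action
  \<open>x \<mapsto> x \<circ> inv w\<close> the same alcove would be labelled by the inverse.) With this convention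
  the alcove of \<open>inv w\<close> lies in the Sommers region iff \<open>w i - w j \<noteq> m\<close> for all \<open>i < j\<close>.
\<close>

definition ext_coord :: "nat \<Rightarrow> (int \<Rightarrow> real) \<Rightarrow> int \<Rightarrow> real" where
  "ext_coord n x i = x ((i - 1) mod int n + 1) - of_int ((i - 1) div int n)"

definition act :: "nat \<Rightarrow> (int \<Rightarrow> real) \<Rightarrow> (int \<Rightarrow> int) \<Rightarrow> int \<Rightarrow> real" where
  "act n x w = (\<lambda>i. if i \<in> {1..int n} then ext_coord n x (w i) else 0)"

definition alcove :: "nat \<Rightarrow> (int \<Rightarrow> int) \<Rightarrow> (int \<Rightarrow> real) set" where
  "alcove n w = (\<lambda>x. act n x w) ` fundamental_alcove n"

definition sommers :: "nat \<Rightarrow> nat \<Rightarrow> (int \<Rightarrow> int) set" where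
  "sommers m n = {w \<in> affine_sym n. alcove n w \<subseteq> sommers_region m n}"


definition level :: "nat \<Rightarrow> nat \<Rightarrow> int \<Rightarrow> int \<Rightarrow> int" where
  "level m n i j = i * int m + j * int n"

definition mn_filter :: "nat \<Rightarrow> nat \<Rightarrow> (int \<times> int) set \<Rightarrow> bool" where
  "mn_filter m n F \<longleftrightarrow> F \<noteq> {} \<and> F \<noteq> UNIV
     \<and> (\<forall>i j i' j'. (i, j) \<in> F \<and> i \<le> i' \<and> j \<le> j' \<longrightarrow> (i', j') \<in> F)
     \<and> (\<forall>i j i' j'. (i, j) \<in> F \<and> level m n i' j' = level m n i j \<longrightarrow> (i', j') \<in> F)"

definition m_mins :: "nat \<Rightarrow> nat \<Rightarrow> (int \<times> int) set \<Rightarrow> int set" where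
  "m_mins m n F = {level m n i j | i j.
     (i, j) \<in> F \<and> (\<forall>i'. (i', j) \<in> F \<longrightarrow> level m n i j \<le> level m n i' j)}"

definition n_mins :: "nat \<Rightarrow> nat \<Rightarrow> (int \<times> int) set \<Rightarrow> int set" where
  "n_mins m n F = {level m n i j | i j.
     (i, j) \<in> F \<and> (\<forall>j'. (i, j') \<in> F \<longrightarrow> level m n i j \<le> level m n i j')}"

definition balanced :: "nat \<Rightarrow> nat \<Rightarrow> (int \<times> int) set \<Rightarrow> bool" where
  "balanced m n F \<longleftrightarrow> mn_filter m n F
     \<and> (\<Sum>x \<in> m_mins m n F. x) = int ((m + 1) choose 2)
     \<and> (\<Sum>y \<in> n_mins m n F. y) = int ((n + 1) choose 2)"

end

theory Submission
  imports Defs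
begin

text \<open>
  The level map identifies \<open>(m, n)\<close>-filters with the nonempty proper sets \<open>S\<close> of integers closed
  under adding \<open>m\<close> and \<open>n\<close>; under it \<open>n(b)\<close> becomes \<open>S - (S + n)\<close> and \<open>m(b)\<close> becomes
  \<open>S - (S + m)\<close>. Both balance conditions say that \<open>S\<close> has as many nonpositive elements as there are
  positive integers outside \<open>S\<close>, so either one implies the other. A dominant \<open>w\<close> corresponds to
  \<open>S = w ` {1..}\<close>, which is closed under adding \<open>n\<close> and satisfies \<open>S - (S + n) = w ` {1..n}\<close>.
  Evaluated on an alcove, the inequalities of the Sommers region say that
  \<open>inv w i < inv w (i + m)\<close> for all \<open>i\<close>, and by dominance this is closure of \<open>S\<close> under adding \<open>m\<close>.
\<close>

section \<open>Filters as sets of levels\<close>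

text \<open>If \<open>S\<close> is bounded below and closed under adding \<open>p > 0\<close>, this
  is the least element of each residue class mod \<open>p\<close> that meets \<open>S\<close>, as in
  the Apery set of a numerical semigroup.\<close>

definition gap_set :: "nat \<Rightarrow> int set \<Rightarrow> int set" where
  "gap_set p S = {x \<in> S. x - int p \<notin> S}"

definition semimodule :: "nat \<Rightarrow> nat \<Rightarrow> int set \<Rightarrow> bool" where
  "semimodule m n S \<longleftrightarrow>
     S \<noteq> {} \<and> S \<noteq> UNIV \<and> (\<forall>x\<in>S. x + int m \<in> S) \<and> (\<forall>x\<in>S. x + int n \<in> S)"

definition level_filter :: "nat \<Rightarrow> nat \<Rightarrow> int set \<Rightarrow> (int \<times> int) set" where
  "level_filter m n S = {(i, j). level m n i j \<in> S}"

lemma level_surj: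
  assumes "coprime m n"
  obtains i j where "level m n i j = x"
proof -
  obtain u v where "u * int m + v * int n = gcd (int m) (int n)"
    using bezout_int by blast
  then have "u * int m + v * int n = 1"
    using assms by simp
  then have "level m n (x * u) (x * v) = x"
    by (metis level_def distrib_left mult.assoc mult.right_neutral)
  then show thesis by (rule that)
qed

lemma add_multiple_mem:
  fixes S :: "int set"
  assumes "\<forall>x\<in>S. x + p \<in> S" "x \<in> S" "k \<ge> 0"
  shows "x + k * p \<in> S"
  using assms(3)
proof (induction k rule: int_ge_induct)
  case base
  then show ?case using assms(2) by simp
next
  case (step k)
  then have "x + k * p + p \<in> S" using assms(1) by blast
  then show ?case by (simp add: algebra_simps)
qed

text \<open>The Frobenius coin bound: write \<open>y - x\<close> as \<open>a * m + b * n\<close> and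
  reduce \<open>a\<close> modulo \<open>n\<close>, moving the excess into \<open>b\<close>. The
  \<open>m\<close> part is then at most \<open>m * n\<close>, so the coefficient of \<open>n\<close>
  cannot be negative.\<close>

lemma semimodule_mem_ge:
  assumes "coprime m n" "m > 0" "n > 0" "semimodule m n S" "x \<in> S" "y \<ge> x + int m * int n"
  shows "y \<in> S"
proof -
  obtain a b where ab: "level m n a b = y - x"
    using level_surj[OF assms(1)] .
  define a' where "a' = a mod int n"
  define b' where "b' = b + (a div int n) * int m"
  have "a = a div int n * int n + a'" by (simp add: a'_def)
  then have "a * int m = (a div int n * int n + a') * int m" by simp
  then have y: "y = x + a' * int m + b' * int n"
    using ab by (simp add: level_def b'_def algebra_simps)
  have a': "0 \<le> a'" "a' \<le> int n" using assms(3) by (simp_all add: a'_def less_imp_le)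
  then have "a' * int m \<le> int n * int m" by (intro mult_right_mono) auto
  then have "b' * int n \<ge> 0" using y assms(6) by (simp add: algebra_simps)
  then have "b' \<ge> 0" using assms(3) by (simp add: zero_le_mult_iff)
  then show ?thesis
    unfolding y using a' assms(4,5) by (auto simp: semimodule_def intro!: add_multiple_mem)
qed

lemma semimodule_bounds:
  assumes "coprime m n" "m > 0" "n > 0" "semimodule m n S"
  obtains L U where "S \<subseteq> {L<..}" "{U<..} \<subseteq> S" "L \<le> U"
proof -
  obtain x z where xz: "x \<in> S" "z \<notin> S" using assms(4) unfolding semimodule_def by blast
  \<comment> \<open>An element of \<open>S\<close> at or below this bound would force
    \<open>z\<close> into \<open>S\<close>.\<close>
  have "S \<subseteq> {z - int m * int n<..}"
    using semimodule_mem_ge[OF assms, where y = z] xz by force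
  moreover have "{x + int m * int n<..} \<subseteq> S"
    using semimodule_mem_ge[OF assms xz(1)] by auto
  \<comment> \<open>Taking the maximum guarantees \<open>L \<le> U\<close>, so that the window
    \<open>{L<..U}\<close> and the full tail above \<open>U\<close> fit together in the sum
    formula.\<close>
  ultimately show thesis
    by (intro that[of "z - int m * int n" "max (z - int m * int n) (x + int m * int n)"]) auto
qed

lemma mn_filter_level_filter:
  assumes "coprime m n" "semimodule m n S"
  shows "mn_filter m n (level_filter m n S)"
proof -
  obtain x z where "x \<in> S" "z \<notin> S" using assms(2) unfolding semimodule_def by blast
  then have "level_filter m n S \<noteq> {} \<and> level_filter m n S \<noteq> UNIV"
    using level_surj[OF assms(1), of x] level_surj[OF assms(1), of z]
    unfolding level_filter_def by (metis (mono_tags, lifting) UNIV_I case_prod_conv empty_iff mem_Collect_eq)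
  moreover have "level m n i' j' \<in> S" if "level m n i j \<in> S" "i \<le> i'" "j \<le> j'" for i j i' j'
  proof -
    have "level m n i j + (i' - i) * int m + (j' - j) * int n \<in> S"
      using that assms(2) by (intro add_multiple_mem) (auto simp: semimodule_def)
    then show ?thesis by (simp add: level_def algebra_simps)
  qed
  ultimately show ?thesis unfolding mn_filter_def level_filter_def by auto
qed

text \<open>Membership in \<open>F\<close> depends on the level alone, so \<open>F\<close> is the
  preimage of its set of levels. Unit steps in the two coordinates add \<open>m\<close> and
  \<open>n\<close> to the level, which turns upward closure into closure of that set.\<close>

lemma mn_filter_cases:
  assumes "coprime m n" "mn_filter m n F"
  obtains S where "semimodule m n S" "F = level_filter m n S"
proof -
  define S where "S = {level m n i j | i j. (i, j) \<in> F}"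
  have mem: "level m n i j \<in> S \<longleftrightarrow> (i, j) \<in> F" for i j
    using assms(2) unfolding S_def mn_filter_def by (smt (verit) mem_Collect_eq)
  have up: "(i', j') \<in> F" if "(i, j) \<in> F" "i \<le> i'" "j \<le> j'" for i j i' j'
    using assms(2) that unfolding mn_filter_def by blast
  have "x + int m \<in> S \<and> x + int n \<in> S" if "x \<in> S" for x
  proof -
    obtain i j where ij: "level m n i j = x" using level_surj[OF assms(1)] .
    then have "level m n (i + 1) j \<in> S" "level m n i (j + 1) \<in> S"
      using that up mem by auto
    then show ?thesis using ij by (auto simp: level_def algebra_simps)
  qed
  moreover have "F \<noteq> {}" "F \<noteq> UNIV"
    using assms(2) by (simp_all only: mn_filter_def simp_thms)
  then have "S \<noteq> {}" "S \<noteq> UNIV"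
    using mem by auto
  ultimately have "semimodule m n S" unfolding semimodule_def by blast
  moreover have "F = level_filter m n S" using mem by (auto simp: level_filter_def)
  ultimately show thesis by (rule that)
qed

text \<open>With \<open>i\<close> fixed, levels run through one residue class mod \<open>n\<close>.
  Closure under adding \<open>n\<close> makes the local test at \<open>x - n\<close> decide whether
  \<open>x\<close> is the minimum of its line.\<close>

lemma n_mins_level_filter:
  assumes "coprime m n" "n > 0" "semimodule m n S"
  shows "n_mins m n (level_filter m n S) = gap_set n S"
proof (intro set_eqI iffI)
  fix x assume "x \<in> n_mins m n (level_filter m n S)"
  then obtain i j where x: "x = level m n i j" "x \<in> S"
    and min: "\<And>j'. level m n i j' \<in> S \<Longrightarrow> x \<le> level m n i j'"
    unfolding n_mins_def level_filter_def by auto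
  have "level m n i (j - 1) = x - int n" by (simp add: x level_def algebra_simps)
  then show "x \<in> gap_set n S" using min[of "j - 1"] x assms(2) by (auto simp: gap_set_def)
next
  fix x assume x: "x \<in> gap_set n S"
  obtain i j where ij: "level m n i j = x" using level_surj[OF assms(1)] .
  have "level m n i j \<le> level m n i j'" if "level m n i j' \<in> S" for j'
  proof (rule ccontr)
    assume "\<not> ?thesis"
    then have "j' \<le> j - 1" using mult_right_mono[of j j' "int n"] by (force simp: level_def)
    then have "level m n i j' + (j - 1 - j') * int n \<in> S"
      using that assms(3) by (intro add_multiple_mem) (auto simp: semimodule_def)
    moreover have "level m n i j' + (j - 1 - j') * int n = x - int n"
      by (simp add: ij[symmetric] level_def algebra_simps)
    ultimately show False using x by (simp add: gap_set_def)
  qed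
  then show "x \<in> n_mins m n (level_filter m n S)"
    using x ij unfolding n_mins_def level_filter_def gap_set_def by auto
qed

text \<open>Transposing the plane exchanges \<open>m\<close> and \<open>n\<close>.\<close>

lemma m_mins_level_filter:
  assumes "coprime m n" "m > 0" "semimodule m n S"
  shows "m_mins m n (level_filter m n S) = gap_set m S"
proof -
  have swap: "level m n i j = level n m j i" for i j by (simp add: level_def)
  have "m_mins m n (level_filter m n S) = n_mins n m (level_filter n m S)"
    unfolding m_mins_def n_mins_def level_filter_def swap by auto
  also have "\<dots> = gap_set m S"
    using assms by (intro n_mins_level_filter) (auto simp: coprime_commute semimodule_def)
  finally show ?thesis .
qed

section \<open>Gap sums and the balance conditions\<close>

lemma gap_set_subset:
  assumes "S \<subseteq> {L<..}" "{U<..} \<subseteq> S"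
  shows "gap_set p S \<subseteq> {L<..U + int p}"
  using assms by (force simp: gap_set_def)

lemma sum_int_shifted_interval: "(\<Sum>x\<in>{U<..U + int p}. x) = int p * U + int ((p + 1) choose 2)"
proof (induction p)
  case (Suc p)
  have "{U<..U + int (Suc p)} = insert (U + int p + 1) {U<..U + int p}" by auto
  then have "(\<Sum>x\<in>{U<..U + int (Suc p)}. x) = U + int p + 1 + (\<Sum>x\<in>{U<..U + int p}. x)"
    by simp
  then show ?case
    using Suc by (simp add: numeral_2_eq_2 field_simps)
qed (simp add: numeral_2_eq_2)

text \<open>
  The sum over \<open>S - (S + p)\<close> telescopes: on a window containing the gaps, it is the sum over \<open>S\<close>
  minus the sum over \<open>S + p\<close>.
\<close>

lemma sum_gap_set:
  assumes "\<forall>x\<in>S. x + int p \<in> S" "S \<subseteq> {L<..}" "{U<..} \<subseteq> S" "L \<le> U"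
  shows "(\<Sum>x\<in>gap_set p S. x) = int ((p + 1) choose 2) + int p * (U - int (card (S \<inter> {L<..U})))"
proof -
  let ?T = "S \<inter> {L<..U}"
  \<comment> \<open>Elements of the longer window are either gaps or \<open>p\<close>-translates of
    elements of \<open>?T\<close>; the sum over \<open>?T\<close> cancels at the end, leaving only
    its cardinality.\<close>
  have "S \<inter> {L<..U + int p} = gap_set p S \<union> (\<lambda>y. y + int p) ` ?T"
  proof (intro set_eqI iffI)
    fix x assume x: "x \<in> S \<inter> {L<..U + int p}"
    show "x \<in> gap_set p S \<union> (\<lambda>y. y + int p) ` ?T"
    proof (cases "x - int p \<in> S")
      case True
      then have "x - int p \<in> ?T" using x assms(2) by auto
      then show ?thesis by force
    qed (use x in \<open>auto simp: gap_set_def\<close>)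
  next
    fix x assume "x \<in> gap_set p S \<union> (\<lambda>y. y + int p) ` ?T"
    then show "x \<in> S \<inter> {L<..U + int p}"
      using assms(1) gap_set_subset[OF assms(2,3), of p] by (auto simp: gap_set_def)
  qed
  moreover have "gap_set p S \<inter> (\<lambda>y. y + int p) ` ?T = {}" by (auto simp: gap_set_def)
  moreover have "finite (gap_set p S)"
    using gap_set_subset[OF assms(2,3)] finite_subset by blast
  ultimately have 1: "(\<Sum>x\<in>S \<inter> {L<..U + int p}. x)
      = (\<Sum>x\<in>gap_set p S. x) + (\<Sum>x\<in>(\<lambda>y. y + int p) ` ?T. x)"
    by (simp add: sum.union_disjoint)
  have 2: "(\<Sum>x\<in>(\<lambda>y. y + int p) ` ?T. x) = (\<Sum>x\<in>?T. x) + int p * int (card ?T)"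
    by (subst sum.reindex) (auto simp: inj_on_def sum.distrib)
  have "S \<inter> {L<..U + int p} = ?T \<union> {U<..U + int p}" using assms(3,4) by auto
  then have 3: "(\<Sum>x\<in>S \<inter> {L<..U + int p}. x) = (\<Sum>x\<in>?T. x) + (\<Sum>x\<in>{U<..U + int p}. x)"
    by (simp only:) (rule sum.union_disjoint, auto)
  show ?thesis
    using 1 2 3 by (simp add: sum_int_shifted_interval right_diff_distrib)
qed

text \<open>By the sum formula, the two gap sums miss their targets by \<open>m\<close> and
  \<open>n\<close> times the same integer \<open>U - card (S \<inter> {L<..U})\<close>, so both
  conditions hold as soon as one does.\<close>

lemma balanced_level_filter_iff:
  assumes "coprime m n" "m > 0" "n > 0" "semimodule m n S"
  shows "balanced m n (level_filter m n S) \<longleftrightarrow> (\<Sum>x\<in>gap_set n S. x) = int ((n + 1) choose 2)"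
proof -
  obtain L U where LU: "S \<subseteq> {L<..}" "{U<..} \<subseteq> S" "L \<le> U"
    using semimodule_bounds[OF assms] .
  have "(\<Sum>x\<in>gap_set p S. x) = int ((p + 1) choose 2) \<longleftrightarrow> U = int (card (S \<inter> {L<..U}))"
    if "p \<in> {m, n}" for p
  proof -
    have "\<forall>x\<in>S. x + int p \<in> S" "p > 0" using that assms unfolding semimodule_def by auto
    then show ?thesis using sum_gap_set[OF _ LU] by simp
  qed
  then show ?thesis
    using assms by (simp add: balanced_def mn_filter_level_filter n_mins_level_filter
        m_mins_level_filter)
qed

section \<open>Affine permutations\<close>

lemma sum_atLeastAtMost_int: "(\<Sum>i = 1..int n. i) = int ((n + 1) choose 2)"
proof -
  have "{1..int n} = {0<..0 + int n}" by auto
  then show ?thesis using sum_int_shifted_interval[of 0 n] by simp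
qed

lemma periodic_add_multiple:
  fixes f :: "int \<Rightarrow> 'a::ring_1" and p :: int
  assumes "\<And>i. f (i + p) = f i + c"
  shows "f (i + k * p) = f i + of_int k * c"
proof (induction k rule: int_induct[where k = 0])
  case (step1 k)
  then show ?case using assms[of "i + k * p"] by (simp add: algebra_simps)
next
  case (step2 k)
  then show ?case using assms[of "i + (k - 1) * p"] by (simp add: algebra_simps)
qed simp

lemma affine_sym_add_multiple:
  assumes "w \<in> affine_sym n"
  shows "w (i + k * int n) = w i + k * int n"
  using periodic_add_multiple[of w "int n" "int n"] assms by (simp add: affine_sym_def)

lemma int_residue_decomp:
  assumes "n > 0"
  obtains i k where "i \<in> {1..int n}" "j = i + k * int n"
proof
  show "(j - 1) mod int n + 1 \<in> {1..int n}"
    using assms by (simp add: add1_zle_eq)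
  show "j = (j - 1) mod int n + 1 + (j - 1) div int n * int n"
    using div_mult_mod_eq[of "j - 1" "int n"] by linarith
qed

lemma residues_unique:
  assumes "i \<in> {1..int n}" "j \<in> {1..int n}" "i = j + k * int n"
  shows "i = j"
proof -
  have "(i - 1) mod int n = (j - 1) mod int n" using assms(3)
    by (metis add_diff_eq diff_add_eq mod_mult_self1)
  then show ?thesis using assms(1,2) by simp
qed

text \<open>Reduced mod \<open>n\<close>, the values \<open>w 1, ..., w n\<close> are a permutation
  of \<open>1, ..., n\<close>, and \<open>g\<close> sees only residues.\<close>

lemma sum_periodic_affine_sym:
  fixes g :: "int \<Rightarrow> 'a::ring_1"
  assumes "n > 0" "w \<in> affine_sym n" "\<And>i. g (i + int n) = g i"
  shows "(\<Sum>i = 1..int n. g (w i)) = (\<Sum>i = 1..int n. g i)"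
proof -
  define r where "r i = (w i - 1) mod int n + 1" for i
  have w: "w i = r i + (w i - 1) div int n * int n" for i
    using div_mult_mod_eq[of "w i - 1" "int n"] unfolding r_def by linarith
  have inj_w: "inj w" using assms(2) by (auto simp: affine_sym_def bij_is_inj)
  have "inj_on r {1..int n}"
  proof (rule inj_onI)
    fix i j assume ij: "i \<in> {1..int n}" "j \<in> {1..int n}" "r i = r j"
    define k where "k = (w i - 1) div int n - (w j - 1) div int n"
    have "w i = w j + k * int n"
      using w[of i] w[of j] ij(3) by (simp add: k_def algebra_simps)
    then have "w i = w (j + k * int n)" by (simp add: affine_sym_add_multiple[OF assms(2)])
    then have "i = j + k * int n" using inj_w by (simp add: inj_eq)
    then show "i = j" using residues_unique ij by blast
  qed
  moreover have "r ` {1..int n} \<subseteq> {1..int n}"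
    using assms(1) by (auto simp: r_def add1_zle_eq)
  ultimately have "bij_betw r {1..int n} {1..int n}"
    by (simp add: bij_betw_def endo_inj_surj)
  moreover have "g (w i) = g (r i)" for i
    using periodic_add_multiple[of g "int n" 0 "r i" "(w i - 1) div int n"] assms(3) w[of i] by simp
  ultimately show ?thesis by (simp add: sum.reindex_bij_betw)
qed

lemma inv_affine_sym:
  assumes "n > 0" "w \<in> affine_sym n"
  shows "inv w \<in> affine_sym n"
proof -
  have w: "bij w" "\<And>i. w (i + int n) = w i + int n"
    "(\<Sum>i = 1..int n. w i) = int ((n + 1) choose 2)"
    using assms(2) by (auto simp: affine_sym_def)
  have inv_w: "inv w (w i) = i" "w (inv w i) = i" for i
    using w(1) by (auto simp: bij_is_inj bij_is_surj surj_f_inv_f)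
  have per: "inv w (i + int n) = inv w i + int n" for i
    using w(2)[of "inv w i"] inv_w by metis
  \<comment> \<open>The displacement of \<open>inv w\<close> is \<open>n\<close>-periodic; evaluated
    at \<open>w i\<close> it is \<open>i - w i\<close>, whose sum is known.\<close>
  have "(\<Sum>i = 1..int n. inv w (w i) - w i) = (\<Sum>i = 1..int n. inv w i - i)"
    using sum_periodic_affine_sym[OF assms, of "\<lambda>i. inv w i - i"] per by simp
  then have "(\<Sum>i = 1..int n. inv w i) = int ((n + 1) choose 2)"
    using w(3) by (simp add: inv_w sum_subtractf sum_atLeastAtMost_int)
  then show ?thesis
    using w(1) per by (simp add: affine_sym_def bij_imp_bij_inv)
qed

section \<open>Alcoves in the Sommers region\<close>

lemma ext_coord_add: "n > 0 \<Longrightarrow> ext_coord n x (i + int n) = ext_coord n x i - 1"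
  using div_mult_self1[of "int n" "i - 1" 1] mod_mult_self1[of "i - 1" 1 "int n"]
  by (simp add: ext_coord_def algebra_simps)

lemma ext_coord_add_multiple:
  "n > 0 \<Longrightarrow> ext_coord n x (i + k * int n) = ext_coord n x i - of_int k"
  using periodic_add_multiple[of "ext_coord n x" "int n" "-1"] ext_coord_add by simp

lemma ext_coord_eq: "i \<in> {1..int n} \<Longrightarrow> ext_coord n x i = x i"
  by (simp add: ext_coord_def)

text \<open>The walls of the fundamental alcove say exactly that consecutive extended coordinates
  decrease; the affine wall is the step from \<open>n\<close> to \<open>n + 1\<close>, where the
  coordinate is \<open>x 1 - 1\<close>.\<close>

lemma ext_coord_strict_antimono:
  assumes "n > 0" "x \<in> fundamental_alcove n"
  shows "ext_coord n x a < ext_coord n x b \<longleftrightarrow> b < a"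
proof -
  have step: "ext_coord n x (i + 1) < ext_coord n x i" for i
  proof -
    obtain i' k where i: "i' \<in> {1..int n}" "i = i' + k * int n"
      using int_residue_decomp[OF assms(1)] .
    have "ext_coord n x (i' + 1) < ext_coord n x i'"
    proof (cases "i' = int n")
      case True
      have "ext_coord n x (1 + int n) = x 1 - 1"
        using assms(1) by (simp only: ext_coord_add) (simp add: ext_coord_eq)
      then show ?thesis
        using True assms by (simp add: ext_coord_eq fundamental_alcove_def add.commute)
    next
      case False
      then show ?thesis
        using i(1) assms(2) by (simp add: ext_coord_eq fundamental_alcove_def)
    qed
    moreover have "i + 1 = i' + 1 + k * int n" using i(2) by simp
    ultimately show ?thesis
      by (simp only: i(2) ext_coord_add_multiple[OF assms(1)])
  qed
  have less: "ext_coord n x a < ext_coord n x b" if "b < a" for a b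
    using that
  proof (induction a rule: int_gr_induct)
    case (step a)
    then show ?case using \<open>\<And>i. ext_coord n x (i + 1) < ext_coord n x i\<close>[of a] by simp
  qed (rule step)
  show ?thesis using less[of a b] less[of b a] by (metis less_asym linorder_neqE_linordered_idom order_less_irrefl)
qed

lemma fundamental_alcove_nonempty:
  assumes "n > 0"
  shows "fundamental_alcove n \<noteq> {}"
proof -
  \<comment> \<open>The barycenter of the alcove: every simple affine root takes the value
    \<open>1 / n\<close> there.\<close>
  define x :: "int \<Rightarrow> real" where
    "x i = (if i \<in> {1..int n} then (real n + 1 - 2 * of_int i) / (2 * real n) else 0)" for i
  have "real_of_int (\<Sum>i = 1..int n. i) = real n * (real n + 1) / 2"
    unfolding sum_atLeastAtMost_int by (simp add: binomial_gbinomial gbinomial_prod_rev numeral_2_eq_2 field_simps)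
  then have "(\<Sum>i = 1..int n. real n + 1 - 2 * of_int i) = 0"
    by (simp add: sum_subtractf sum.distrib sum_distrib_left[symmetric])
  then have "(\<Sum>i = 1..int n. x i) = 0"
    by (simp add: x_def sum_divide_distrib[symmetric])
  then have "x \<in> coweight_space n" by (simp add: coweight_space_def x_def)
  moreover have "x i > x (i + 1)" if "1 \<le> i" "i < int n" for i
    using that by (simp add: x_def divide_strict_right_mono)
  moreover have "x 1 - x (int n) < 1"
    using assms by (simp add: x_def field_simps)
  ultimately show ?thesis by (auto simp: fundamental_alcove_def)
qed

lemma act_mem_coweight_space:
  assumes "n > 0" "v \<in> affine_sym n" "x \<in> coweight_space n"
  shows "act n x v \<in> coweight_space n"
proof -
  \<comment> \<open>The term \<open>i / n\<close> offsets the drop by 1 per period, making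
    \<open>g\<close> periodic. Its total is unchanged by \<open>v\<close> because of the
    normalization of the window sum.\<close>
  define g :: "int \<Rightarrow> real" where "g i = ext_coord n x i + of_int i / real n" for i
  have "g (i + int n) = g i" for i
    using assms(1) by (simp add: g_def ext_coord_add add_divide_distrib)
  then have "(\<Sum>i = 1..int n. g (v i)) = (\<Sum>i = 1..int n. g i)"
    by (rule sum_periodic_affine_sym[OF assms(1,2)])
  moreover have "(\<Sum>i = 1..int n. real_of_int (v i)) = (\<Sum>i = 1..int n. real_of_int i)"
    using assms(2) sum_atLeastAtMost_int[of n]
    by (simp add: affine_sym_def flip: of_int_sum)
  ultimately have "(\<Sum>i = 1..int n. ext_coord n x (v i)) = (\<Sum>i = 1..int n. ext_coord n x i)"
    by (simp add: g_def sum.distrib flip: sum_divide_distrib)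
  also have "\<dots> = (\<Sum>i = 1..int n. x i)" by (intro sum.cong) (auto simp: ext_coord_eq)
  also have "\<dots> = 0" using assms(3) by (simp add: coweight_space_def)
  finally show ?thesis by (simp add: coweight_space_def act_def)
qed

text \<open>Height \<open>m\<close> means \<open>i + m = j + k * n\<close>, so the constant
  \<open>k\<close> is absorbed by passing from entry \<open>j\<close> to entry \<open>i + m\<close>
  of the extended coordinates.\<close>

lemma root_val_act:
  assumes "n > 0" "v \<in> affine_sym n" "(i, j, k) \<in> affine_roots n"
    "root_height n (i, j, k) = int m"
  shows "root_val (i, j, k) (act n x v) = ext_coord n x (v i) - ext_coord n x (v (i + int m))"
proof -
  have "i + int m = j + k * int n" using assms(4) by simp
  then show ?thesis
    using assms(1,3) affine_sym_add_multiple[OF assms(2), of j k]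
    by (simp add: act_def affine_roots_def ext_coord_add_multiple)
qed

lemma affine_root_of_height:
  assumes "n > 0" "i \<in> {1..int n}" "\<not> n dvd m"
  obtains j k where "(i, j, k) \<in> affine_roots n" "root_height n (i, j, k) = int m"
proof -
  obtain j k where jk: "j \<in> {1..int n}" "i + int m = j + k * int n"
    using int_residue_decomp[OF assms(1)] .
  have "i \<noteq> j"
  proof
    assume "i = j"
    then have "int n dvd int m" using jk(2) by simp
    then show False using assms(3) by simp
  qed
  then show thesis using jk assms(2) by (intro that[of j k]) (auto simp: affine_roots_def)
qed

lemma mem_sommers_iff:
  assumes "n > 0" "m > 0" "v \<in> affine_sym n"
  shows "v \<in> sommers m n \<longleftrightarrow> (\<forall>i. v i < v (i + int m))"
proof
  assume v: "v \<in> sommers m n"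
  have key: "v i < v (i + int m)" if i: "i \<in> {1..int n}" for i
  proof (cases "n dvd m")
    \<comment> \<open>Here no root \<open>(i, j, k)\<close> has height \<open>m\<close>, as it would
      need \<open>j = i\<close>; periodicity gives \<open>v (i + m) = v i + m\<close>
      instead.\<close>
    case True
    then obtain k where "m = n * k" by (rule dvdE)
    then show ?thesis
      using affine_sym_add_multiple[OF assms(3), of i "int k"] assms(2) by (simp add: mult.commute)
  next
    case False
    obtain j k where jk: "(i, j, k) \<in> affine_roots n" "root_height n (i, j, k) = int m"
      using affine_root_of_height[OF assms(1) i False] .
    \<comment> \<open>One point suffices, since the order of the extended coordinates is the same
      throughout the alcove.\<close>
    obtain x where x: "x \<in> fundamental_alcove n"
      using fundamental_alcove_nonempty[OF assms(1)] by blast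
    then have "act n x v \<in> sommers_region m n"
      using v by (auto simp: sommers_def alcove_def)
    then have "root_val (i, j, k) (act n x v) > 0"
      using jk unfolding sommers_region_def by blast
    then show ?thesis
      using root_val_act[OF assms(1,3) jk] ext_coord_strict_antimono[OF assms(1) x] by simp
  qed
  show "\<forall>i. v i < v (i + int m)"
  proof
    fix i
    obtain i' k where i: "i' \<in> {1..int n}" "i = i' + k * int n"
      using int_residue_decomp[OF assms(1)] .
    have "i + int m = i' + int m + k * int n" using i(2) by simp
    then show "v i < v (i + int m)"
      using key[OF i(1)] by (simp only: i(2) affine_sym_add_multiple[OF assms(3)])
  qed
next
  assume mono: "\<forall>i. v i < v (i + int m)"
  have "act n x v \<in> sommers_region m n" if x: "x \<in> fundamental_alcove n" for x
  proof -
    have "act n x v \<in> coweight_space n"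
      using act_mem_coweight_space[OF assms(1,3)] x by (simp add: fundamental_alcove_def)
    moreover have "root_val r (act n x v) > 0"
      if "r \<in> affine_roots n" "root_height n r = int m" for r
    proof -
      obtain i j k where r: "r = (i, j, k)" using prod_cases3 .
      show ?thesis
        using root_val_act[OF assms(1,3)] that mono ext_coord_strict_antimono[OF assms(1) x]
        unfolding r by simp
    qed
    ultimately show ?thesis by (simp add: sommers_region_def)
  qed
  then show "v \<in> sommers m n" using assms(3) by (auto simp: sommers_def alcove_def)
qed

section \<open>Dominant permutations and semimodules\<close>

lemma gap_set_affine_sym:
  assumes "w \<in> affine_sym n"
  shows "gap_set n (w ` {1..}) = w ` {1..int n}"
proof -
  have inj: "w i = w j \<longleftrightarrow> i = j" for i j
    using assms by (auto simp: affine_sym_def bij_is_inj inj_eq)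
  have "w i - int n = w (i - int n)" for i
    using affine_sym_add_multiple[OF assms, of i "-1"] by simp
  then show ?thesis by (auto simp: gap_set_def inj image_iff)
qed

text \<open>A set bounded below and closed under adding \<open>n\<close> is generated by its gaps:
  subtracting \<open>n\<close> repeatedly must leave \<open>S\<close>, and the last element before
  that is a gap. The induction is on the distance to \<open>L\<close>.\<close>

lemma image_positive_eq:
  assumes "n > 0" "w \<in> affine_sym n" "\<forall>x\<in>S. x + int n \<in> S" "S \<subseteq> {L<..}"
    "gap_set n S = w ` {1..int n}"
  shows "w ` {1..} = S"
proof (intro set_eqI iffI)
  fix x assume "x \<in> w ` {1..}"
  then obtain i where i: "x = w i" "i \<ge> 1" by auto
  obtain i' k where i': "i' \<in> {1..int n}" "i = i' + k * int n"
    using int_residue_decomp[OF assms(1)] .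
  have "k \<ge> 0"
  proof (rule ccontr)
    assume "\<not> ?thesis"
    then have "k * int n \<le> -1 * int n" by (intro mult_right_mono) auto
    then show False using i i' by auto
  qed
  moreover have "w i' \<in> S" using i'(1) assms(5) by (auto simp: gap_set_def)
  ultimately show "x \<in> S"
    unfolding i(1) i'(2) affine_sym_add_multiple[OF assms(2)]
    by (intro add_multiple_mem assms(3))
next
  fix x assume "x \<in> S"
  then show "x \<in> w ` {1..}"
  proof (induction "nat (x - L)" arbitrary: x rule: less_induct)
    case less
    show ?case
    proof (cases "x - int n \<in> S")
      case True
      then have "L < x - int n" using assms(4) by auto
      then have "x - int n \<in> w ` {1..}" using less(1) True assms(1) by simp
      then obtain i where "x - int n = w i" "i \<ge> 1" by auto
      then have "x = w (i + int n)" "i + int n \<ge> 1"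
        using affine_sym_add_multiple[OF assms(2), of i 1] by auto
      then show ?thesis by auto
    next
      case False
      then have "x \<in> w ` {1..int n}" using assms(5) less.prems by (auto simp: gap_set_def)
      then show ?thesis by auto
    qed
  qed
qed

text \<open>Membership in the image means \<open>inv w x \<ge> 1\<close>. For \<open>i\<close> in
  the window, closure puts \<open>w i + m\<close> at a position \<open>j \<ge> 1\<close>: either
  \<open>j > n \<ge> i\<close>, or dominance compares \<open>i\<close> and \<open>j\<close> inside
  the window. Periodicity extends this to all integers.\<close>

lemma inv_increasing_iff_closed:
  assumes "n > 0" "m > 0" "w \<in> affine_sym n" "dominant n w"
  shows "(\<forall>i. inv w i < inv w (i + int m)) \<longleftrightarrow> (\<forall>x\<in>w ` {1..}. x + int m \<in> w ` {1..})"
    (is "?mono \<longleftrightarrow> ?closed")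
proof -
  have inv_w: "inv w (w i) = i" "w (inv w i) = i" for i
    using assms(3) by (auto simp: affine_sym_def bij_is_inj bij_is_surj surj_f_inv_f)
  have mem: "x \<in> w ` {1..} \<longleftrightarrow> inv w x \<ge> 1" for x
    using inv_w by (metis atLeast_iff image_iff)
  show ?thesis
  proof
    assume mono: ?mono
    show ?closed
    proof
      fix x assume "x \<in> w ` {1..}"
      then show "x + int m \<in> w ` {1..}" using mono[rule_format, of x] unfolding mem by simp
    qed
  next
    assume closed: ?closed
    have key: "i < inv w (w i + int m)" if i: "i \<in> {1..int n}" for i
    proof -
      define j where "j = inv w (w i + int m)"
      have j: "w j = w i + int m" by (simp add: j_def inv_w)
      have "j \<ge> 1" using closed i unfolding j_def mem by (simp add: inv_w)
      have "i < j"
      proof (cases "j \<le> int n")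
        case True
        show ?thesis
        proof (rule ccontr)
          assume "\<not> ?thesis"
          then have "w j \<le> w i"
            using strict_mono_on_leD[of "{1..int n}" w j i] assms(4) i \<open>j \<ge> 1\<close> True
            by (simp add: dominant_def)
          then show False using j assms(2) by simp
        qed
      qed (use i in auto)
      then show ?thesis by (simp add: j_def)
    qed
    show ?mono
    proof
      fix x
      obtain i k where i: "i \<in> {1..int n}" "inv w x = i + k * int n"
        using int_residue_decomp[OF assms(1)] .
      have "x = w i + k * int n"
        using i(2) inv_w(2)[of x] affine_sym_add_multiple[OF assms(3)] by simp
      then have "x + int m = w i + int m + k * int n" by simp
      then have "inv w (x + int m) = inv w (w i + int m) + k * int n"
        by (simp only: affine_sym_add_multiple[OF inv_affine_sym[OF assms(1,3)]])
      then show "inv w x < inv w (x + int m)" using key[OF i(1)] i(2) by simp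
    qed
  qed
qed

lemma dominant_eq_sorted_list_iff:
  assumes "n > 0" "dominant n w" "finite A"
  shows "map w [1..int n] = sorted_list_of_set A \<longleftrightarrow> w ` {1..int n} = A"
proof
  assume "map w [1..int n] = sorted_list_of_set A"
  then have "set (map w [1..int n]) = set (sorted_list_of_set A)" by simp
  then show "w ` {1..int n} = A" using assms(3) by simp
next
  assume A: "w ` {1..int n} = A"
  have w: "strict_mono_on {1..int n} w" using assms(2) by (simp add: dominant_def)
  have "sorted (map w [1..int n])"
    unfolding sorted_map
  proof (rule sorted_wrt_mono_rel[OF _ sorted_upto])
    fix i j assume "i \<in> set [1..int n]" "j \<in> set [1..int n]" "i \<le> j"
    then show "w i \<le> w j" using strict_mono_on_leD[OF w, of i j] by simp
  qed
  moreover have "distinct (map w [1..int n])"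
    using strict_mono_on_imp_inj_on[OF w] by (simp add: distinct_map)
  ultimately show "map w [1..int n] = sorted_list_of_set A"
    using A assms(3) by (intro sorted_distinct_set_unique) auto
qed

theorem theorem6p6:
  fixes m n :: nat and w :: "int \<Rightarrow> int"
  assumes "m > 0" and "n > 0" and "coprime m n"
    and "w \<in> affine_sym n" and "dominant n w"
  shows "inv w \<in> sommers m n \<longleftrightarrow>
    (\<exists>b. balanced m n b \<and> map w [1..int n] = sorted_list_of_set (n_mins m n b))"
proof -
  let ?N = "w ` {1..}"
  have sommers: "inv w \<in> sommers m n \<longleftrightarrow> (\<forall>x\<in>?N. x + int m \<in> ?N)"
    using mem_sommers_iff[OF assms(2,1) inv_affine_sym[OF assms(2,4)]]
      inv_increasing_iff_closed[OF assms(2,1,4,5)] by simp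
  have inj: "inj w" using assms(4) by (simp add: affine_sym_def bij_is_inj)
  show ?thesis
  proof
    assume "inv w \<in> sommers m n"
    moreover have "x + int n \<in> ?N" if x: "x \<in> ?N" for x
    proof -
      obtain i where "x = w i" "i \<ge> 1" using x by auto
      then have "x + int n = w (i + int n)" "i + int n \<ge> 1"
        using affine_sym_add_multiple[OF assms(4), of i 1] by auto
      then show ?thesis by auto
    qed
    \<comment> \<open>This makes \<open>?N\<close> a proper subset.\<close>
    moreover have "w 0 \<notin> ?N" using inj by (auto simp: inj_eq)
    ultimately have N: "semimodule m n ?N"
      unfolding semimodule_def sommers by blast
    \<comment> \<open>The normalization of \<open>w\<close> is the \<open>n\<close>-balance
      condition; the \<open>m\<close>-balance comes with it.\<close>
    have "(\<Sum>x\<in>w ` {1..int n}. x) = int ((n + 1) choose 2)"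
      using assms(4) inj by (simp add: sum.reindex inj_on_subset affine_sym_def)
    then have "balanced m n (level_filter m n ?N)"
      using N assms(1-4) by (simp add: balanced_level_filter_iff gap_set_affine_sym)
    moreover have "map w [1..int n] = sorted_list_of_set (n_mins m n (level_filter m n ?N))"
      using N assms by (simp add: n_mins_level_filter gap_set_affine_sym
          dominant_eq_sorted_list_iff)
    ultimately show "\<exists>b. balanced m n b \<and> map w [1..int n] = sorted_list_of_set (n_mins m n b)"
      by blast
  next
    assume "\<exists>b. balanced m n b \<and> map w [1..int n] = sorted_list_of_set (n_mins m n b)"
    then obtain b where b: "balanced m n b" "map w [1..int n] = sorted_list_of_set (n_mins m n b)"
      by blast
    obtain S where S: "semimodule m n S" "b = level_filter m n S"
      using b(1) mn_filter_cases[OF assms(3)] unfolding balanced_def by blast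
    obtain L U where LU: "S \<subseteq> {L<..}" "{U<..} \<subseteq> S"
      using semimodule_bounds[OF assms(3,1,2) S(1)] .
    \<comment> \<open>Finiteness excludes the default value of \<open>sorted_list_of_set\<close> on
      infinite sets, so the list equation determines the set.\<close>
    have "finite (gap_set n S)"
      using gap_set_subset[OF LU] finite_subset by blast
    then have "gap_set n S = w ` {1..int n}"
      using b(2) S assms by (simp add: n_mins_level_filter dominant_eq_sorted_list_iff)
    then have "?N = S"
      using image_positive_eq[OF assms(2,4) _ LU(1)] S(1) by (simp add: semimodule_def)
    then show "inv w \<in> sommers m n" using S(1) by (simp add: sommers semimodule_def)
  qed
qed

end
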